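(* Let $(\mathfrak g=\mathfrak h\oplus\mathfrak m,g)$ be a naturally reductive decomposition with $\mathfrak g$ its transvection algebra. Let $\overline g$ be the unique $\mathrm{ad}(\mathfrak g)$-invariant non-degenerate symmetric bilinear form on $\mathfrak g$ such that $\overline g|_{\mathfrak m\times\mathfrak m}=g$ and $\mathfrak h\perp\mathfrak m$. Then the decomposition $\mathfrak g=\mathfrak h\oplus\mathfrak m$ is reducible if and only if there exist two non-trivial ideals $\mathfrak g_1\subset\mathfrak g$ and $\mathfrak g_2\subset\mathfrak g$, orthogonal with respect to $\overline g$, such that $\mathfrak g=\mathfrak g_1\oplus\mathfrak g_2$ and $\mathfrak h=\mathfrak h_1\oplus\mathfrak h_2$ with $\mathfrak h_i\subset\mathfrak g_i$ for $i=1,2$.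
   Context: Lie algebras are real and finite-dimensional. A naturally reductive decomposition $(\mathfrak g=\mathfrak h\oplus\mathfrak m,g)$ is a Lie algebra $\mathfrak g$ with a subalgebra $\mathfrak h$ (the isotropy algebra), a complement $\mathfrak m$ of $\mathfrak h$ and a metric (inner product) $g$ on $\mathfrak m$ such that $[\mathfrak h,\mathfrak m]\subset\mathfrak m$, $g$ is $\mathrm{ad}(\mathfrak h)$-invariant (so $\mathrm{ad}:\mathfrak h\to\mathfrak{so}(\mathfrak m)$), and $g([x,y]_{\mathfrak m},z)=-g(y,[x,z]_{\mathfrak m})$ for all $x,y,z\in\mathfrak m$; subscripts denote components in $\mathfrak g=\mathfrak h\oplus\mathfrak m$. Its torsion and curvature are $T(x,y)=-[x,y]_{\mathfrak m}$ and $R(x,y)=-\mathrm{ad}([x,y]_{\mathfrak h})\in\mathfrak{so}(\mathfrak m)$ for $x,y\in\mathfrak m$; $T$ is regarded as the 3-form $T(x,y,z)=g(T(x,y),z)$. The decomposition is effective if $\mathrm{ad}:\mathfrak h\to\mathfrak{so}(\mathfrak m)$ is injective, and $\mathfrak g$ is the transvection algebra of the decomposition if the decomposition is effective and $\mathrm{im}(R)=\mathrm{ad}(\mathfrak h)$ (here $\mathrm{im}(R)$ is the span of all $R(x,y)$). Existence and uniqueness of $\overline g$ is Kostant's theorem. The decomposition is reducible if $T=T_1+T_2\in\Lambda^3\mathfrak m_1\oplus\Lambda^3\mathfrak m_2$ for some non-trivial orthogonal decomposition $\mathfrak m=\mathfrak m_1\oplus\mathfrak m_2$, that is, with $\mathfrak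 m_1,\mathfrak m_2\neq\{0\}$.
   Formalization: The formal theorem excludes the case T=0, dim m≥2 with no proper non-zero ad(h)-invariant subspace of m; there the claim fails, e.g. so(3)=so(2)⊕R² is reducible by definition (T=0) but so(3) is simple. *)

theory Defs
  imports "HOL-Analysis.Analysis" "HOL-Library.Function_Algebras"
begin

section \<open>Lie algebras\<close>

text \<open>A finite-dimensional real Lie algebra is a finite-dimensional real vector space, given as a
  whole type (the zero space is allowed, and no inner product is assumed), with a Lie bracket.
  Its subalgebras, ideals and complements are subsets of that type.\<close>

definition lie_algebra :: "('a::real_vector \<Rightarrow> 'a \<Rightarrow> 'a) \<Rightarrow> bool" where
  "lie_algebra br \<longleftrightarrow>
     (\<exists>B :: 'a set. finite B \<and> span B = UNIV) \<and>
     bilinear br \<and>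
     (\<forall>x. br x x = 0) \<and>
     (\<forall>x y z. br x (br y z) + br y (br z x) + br z (br x y) = 0)"

definition lie_subalgebra :: "('a::real_vector \<Rightarrow> 'a \<Rightarrow> 'a) \<Rightarrow> 'a set \<Rightarrow> bool" where
  "lie_subalgebra br h \<longleftrightarrow> subspace h \<and> (\<forall>x\<in>h. \<forall>y\<in>h. br x y \<in> h)"

definition lie_ideal :: "('a::real_vector \<Rightarrow> 'a \<Rightarrow> 'a) \<Rightarrow> 'a set \<Rightarrow> bool" where
  "lie_ideal br I \<longleftrightarrow> subspace I \<and> (\<forall>x. \<forall>y\<in>I. br x y \<in> I)"

text \<open>\<open>V = U \<oplus> W\<close> as an internal direct sum of linear subspaces.\<close>

definition direct_sum :: "'a::real_vector set \<Rightarrow> 'a set \<Rightarrow> 'a set \<Rightarrow> bool" where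
  "direct_sum V U W \<longleftrightarrow>
     subspace U \<and> subspace W \<and> U \<inter> W = {0} \<and> V = {u + w | u w. u \<in> U \<and> w \<in> W}"

text \<open>The \<open>U\<close>-component of \<open>x\<close> with respect to \<open>U \<oplus> W\<close>.\<close>

definition component :: "'a::real_vector set \<Rightarrow> 'a set \<Rightarrow> 'a \<Rightarrow> 'a" where
  "component U W x = (THE u. u \<in> U \<and> x - u \<in> W)"


section \<open>Multilinear forms on a subspace\<close>

definition linear_form_on :: "'a::real_vector set \<Rightarrow> ('a \<Rightarrow> real) \<Rightarrow> bool" where
  "linear_form_on W f \<longleftrightarrow>
     (\<forall>x\<in>W. \<forall>y\<in>W. f (x + y) = f x + f y) \<and> (\<forall>c. \<forall>x\<in>W. f (c *\<^sub>R x) = c * f x)"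

definition inner_product_on :: "'a::real_vector set \<Rightarrow> ('a \<Rightarrow> 'a \<Rightarrow> real) \<Rightarrow> bool" where
  "inner_product_on W g \<longleftrightarrow>
     (\<forall>x\<in>W. linear_form_on W (\<lambda>y. g x y)) \<and>
     (\<forall>x\<in>W. \<forall>y\<in>W. g x y = g y x) \<and>
     (\<forall>x\<in>W. x \<noteq> 0 \<longrightarrow> g x x > 0)"

definition three_form_on :: "'a::real_vector set \<Rightarrow> ('a \<Rightarrow> 'a \<Rightarrow> 'a \<Rightarrow> real) \<Rightarrow> bool" where
  "three_form_on W T \<longleftrightarrow>
     (\<forall>x\<in>W. \<forall>y\<in>W. linear_form_on W (\<lambda>z. T x y z)) \<and>
     (\<forall>x\<in>W. \<forall>z\<in>W. linear_form_on W (\<lambda>y. T x y z)) \<and>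
     (\<forall>y\<in>W. \<forall>z\<in>W. linear_form_on W (\<lambda>x. T x y z)) \<and>
     (\<forall>x\<in>W. \<forall>y\<in>W. T x x y = 0 \<and> T x y y = 0 \<and> T x y x = 0)"


section \<open>Naturally reductive decompositions\<close>

definition naturally_reductive ::
  "('a::real_vector \<Rightarrow> 'a \<Rightarrow> 'a) \<Rightarrow> 'a set \<Rightarrow> 'a set \<Rightarrow> ('a \<Rightarrow> 'a \<Rightarrow> real) \<Rightarrow> bool" where
  "naturally_reductive br h m g \<longleftrightarrow>
     lie_algebra br \<and> lie_subalgebra br h \<and> direct_sum UNIV h m \<and> inner_product_on m g \<and>
     (\<forall>k\<in>h. \<forall>x\<in>m. br k x \<in> m) \<and>
     (\<forall>k\<in>h. \<forall>x\<in>m. \<forall>y\<in>m. g (br k x) y + g x (br k y) = 0) \<and>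
     (\<forall>x\<in>m. \<forall>y\<in>m. \<forall>z\<in>m.
        g (component m h (br x y)) z = - g y (component m h (br x z)))"

definition torsion ::
  "('a::real_vector \<Rightarrow> 'a \<Rightarrow> 'a) \<Rightarrow> 'a set \<Rightarrow> 'a set \<Rightarrow> 'a \<Rightarrow> 'a \<Rightarrow> 'a" where
  "torsion br h m x y = - component m h (br x y)"

definition torsion_form ::
  "('a::real_vector \<Rightarrow> 'a \<Rightarrow> 'a) \<Rightarrow> 'a set \<Rightarrow> 'a set \<Rightarrow> ('a \<Rightarrow> 'a \<Rightarrow> real) \<Rightarrow> 'a \<Rightarrow> 'a \<Rightarrow> 'a \<Rightarrow> real" where
  "torsion_form br h m g x y z = g (torsion br h m x y) z"

text \<open>Endomorphisms of \<open>m\<close> are represented by functions that vanish outside \<open>m\<close>, so that equality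
  of functions is equality of endomorphisms of \<open>m\<close>; the pointwise operations preserve this.\<close>

definition isotropy_ad ::
  "('a::real_vector \<Rightarrow> 'a \<Rightarrow> 'a) \<Rightarrow> 'a set \<Rightarrow> 'a \<Rightarrow> 'a \<Rightarrow> 'a" where
  "isotropy_ad br m k = (\<lambda>z. if z \<in> m then br k z else 0)"

definition curvature ::
  "('a::real_vector \<Rightarrow> 'a \<Rightarrow> 'a) \<Rightarrow> 'a set \<Rightarrow> 'a set \<Rightarrow> 'a \<Rightarrow> 'a \<Rightarrow> 'a \<Rightarrow> 'a" where
  "curvature br h m x y = - isotropy_ad br m (component h m (br x y))"

definition fun_scale :: "real \<Rightarrow> ('a \<Rightarrow> 'b::real_vector) \<Rightarrow> 'a \<Rightarrow> 'b" where
  "fun_scale c f = (\<lambda>x. c *\<^sub>R f x)"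

lemma vector_space_fun_scale: "vector_space fun_scale"
  by unfold_locales (auto simp: fun_scale_def fun_eq_iff algebra_simps)

definition curvature_image ::
  "('a::real_vector \<Rightarrow> 'a \<Rightarrow> 'a) \<Rightarrow> 'a set \<Rightarrow> 'a set \<Rightarrow> ('a \<Rightarrow> 'a) set" where
  "curvature_image br h m = module.span fun_scale {curvature br h m x y | x y. x \<in> m \<and> y \<in> m}"

definition effective ::
  "('a::real_vector \<Rightarrow> 'a \<Rightarrow> 'a) \<Rightarrow> 'a set \<Rightarrow> 'a set \<Rightarrow> bool" where
  "effective br h m \<longleftrightarrow> inj_on (isotropy_ad br m) h"

definition is_transvection_algebra ::
  "('a::real_vector \<Rightarrow> 'a \<Rightarrow> 'a) \<Rightarrow> 'a set \<Rightarrow> 'a set \<Rightarrow> bool" where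
  "is_transvection_algebra br h m \<longleftrightarrow>
     effective br h m \<and> curvature_image br h m = isotropy_ad br m ` h"

text \<open>The properties characterising the invariant form of Kostant's theorem.\<close>

definition kostant_form ::
  "('a::real_vector \<Rightarrow> 'a \<Rightarrow> 'a) \<Rightarrow> 'a set \<Rightarrow> 'a set \<Rightarrow> ('a \<Rightarrow> 'a \<Rightarrow> real) \<Rightarrow> ('a \<Rightarrow> 'a \<Rightarrow> real) \<Rightarrow> bool" where
  "kostant_form br h m g gbar \<longleftrightarrow>
     bilinear gbar \<and>
     (\<forall>x y. gbar x y = gbar y x) \<and>
     (\<forall>x. (\<forall>y. gbar x y = 0) \<longrightarrow> x = 0) \<and>
     (\<forall>x y z. gbar (br x y) z + gbar y (br x z) = 0) \<and>
     (\<forall>x\<in>m. \<forall>y\<in>m. gbar x y = g x y) \<and>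
     (\<forall>k\<in>h. \<forall>x\<in>m. gbar k x = 0)"

text \<open>A 3-form on \<open>m\<^sub>i\<close> is regarded as a 3-form on \<open>m = m\<^sub>1 \<oplus> m\<^sub>2\<close> by pulling it back along the
  projection to \<open>m\<^sub>i\<close>; this is the embedding used in \<open>T = T\<^sub>1 + T\<^sub>2\<close>.\<close>

definition reducible ::
  "('a::real_vector \<Rightarrow> 'a \<Rightarrow> 'a) \<Rightarrow> 'a set \<Rightarrow> 'a set \<Rightarrow> ('a \<Rightarrow> 'a \<Rightarrow> real) \<Rightarrow> bool" where
  "reducible br h m g \<longleftrightarrow>
     (\<exists>m1 m2 T1 T2.
        direct_sum m m1 m2 \<and> (\<forall>x\<in>m1. \<forall>y\<in>m2. g x y = 0) \<and> m1 \<noteq> {0} \<and> m2 \<noteq> {0} \<and>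
        three_form_on m1 T1 \<and> three_form_on m2 T2 \<and>
        (\<forall>x\<in>m. \<forall>y\<in>m. \<forall>z\<in>m.
           torsion_form br h m g x y z =
             T1 (component m1 m2 x) (component m1 m2 y) (component m1 m2 z) +
             T2 (component m2 m1 x) (component m2 m1 y) (component m2 m1 z)))"

text \<open>For vanishing torsion every orthogonal splitting of \<open>m\<close> satisfies \<open>T = 0 + 0\<close>, so that
  \<^const>\<open>reducible\<close> only says that \<open>m\<close> has dimension at least 2. For an irreducible symmetric pair
  of that kind (for instance \<open>so(3) = so(2) \<oplus> \<real>\<^sup>2\<close>, the 2-sphere) there is no splitting
  into ideals.\<close>

definition irreducible_symmetric ::
  "('a::real_vector \<Rightarrow> 'a \<Rightarrow> 'a) \<Rightarrow> 'a set \<Rightarrow> 'a set \<Rightarrow> bool" where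
  "irreducible_symmetric br h m \<longleftrightarrow>
     (\<forall>x\<in>m. \<forall>y\<in>m. torsion br h m x y = 0) \<and>
     dim m \<ge> 2 \<and>
     (\<forall>W. subspace W \<and> W \<subseteq> m \<and> (\<forall>k\<in>h. \<forall>w\<in>W. br k w \<in> W) \<longrightarrow> W = {0} \<or> W = m)"

end

theory Submission
  imports Defs
begin

text \<open>Write \<open>B\<close> for the invariant form. As \<open>T(x,y,z) = -B([x,y],z)\<close>, splittings of the torsion
  are about the \<open>m\<close>-parts of brackets.

  If the algebra is an orthogonal sum of ideals compatible with \<open>h\<close>, the ideals commute, and
  \<open>m = h\<^sup>\<bottom>\<close> is the sum of its intersections with them. By invariance of \<open>B\<close> the torsion splits
  accordingly. Both intersections are non-zero: otherwise one of the ideals would be contained in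
  \<open>h\<close> and act trivially on \<open>m\<close>, against effectiveness
  (\<open>reducible_if_ideal_splitting\<close>).

  Conversely, it is enough to find a proper non-zero subspace \<open>W\<close> of \<open>m\<close> that is preserved by the
  isotropy and by the torsion (\<open>ideal_splitting_of_invariant_subspace\<close>). For then \<open>W\<close> and its
  orthogonal complement in \<open>m\<close> commute
  (\<open>commuting_splitting_of_invariant_subspace\<close>): the \<open>m\<close>-part of a mixed bracket vanishes by the
  skewness of \<open>T\<close>, and its \<open>h\<close>-part is orthogonal to all \<open>[z,w]\<^sub>h\<close>. These elements span \<open>h\<close> in a
  transvection algebra, and \<open>B\<close> is non-degenerate on \<open>h\<close>, although possibly indefinite there. Each of
  the two subspaces \<open>a\<close>, together with the span of \<open>[a,a]\<^sub>h\<close>, is then an ideal.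

  The summands of a splitting \<open>T = T\<^sub>1 + T\<^sub>2\<close> need not be isotropy invariant, since the splitting
  may cut through the kernel of \<open>T\<close> in an arbitrary way. But if, say, \<open>T\<^sub>1 \<noteq> 0\<close>, the span \<open>W\<close> of
  \<open>T(m\<^sub>1,m\<^sub>1)\<close> is invariant (\<open>ideal_splitting_of_torsion_splitting\<close>). If \<open>T = 0\<close>, the splitting only
  says that \<open>m\<close> has dimension at least two, and \<open>W\<close> is provided by the assumption that the
  decomposition is not an irreducible symmetric one.\<close>


section \<open>Direct sums and orthogonal complements\<close>

lemma component_unique:
  assumes "direct_sum V U W" "u \<in> U" "x - u \<in> W"
  shows "component U W x = u"
  unfolding component_def
proof (rule the_equality)
  fix u' assume u': "u' \<in> U \<and> x - u' \<in> W"
  have U: "subspace U" and W: "subspace W" and UW: "U \<inter> W = {0}"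
    using assms(1) by (auto simp: direct_sum_def)
  have "u' - u \<in> U" using U u' assms(2) by (blast intro: subspace_diff)
  moreover have "(x - u) - (x - u') \<in> W" using W u' assms(3) by (blast intro: subspace_diff)
  then have "u' - u \<in> W" by simp
  ultimately have "u' - u = 0" using UW by blast
  then show "u' = u" by simp
qed (use assms in auto)

lemma direct_sum_commute: "direct_sum V U W \<Longrightarrow> direct_sum V W U"
  unfolding direct_sum_def by (auto simp: Int_commute) (metis add.commute)+

lemma direct_sum_parts:
  assumes "direct_sum V U W"
  shows "U \<subseteq> V" "W \<subseteq> V"
proof -
  have V: "V = {u + w |u w. u \<in> U \<and> w \<in> W}" and z: "0 \<in> U" "0 \<in> W"
    using assms by (auto simp: direct_sum_def subspace_0)
  have "u + 0 \<in> V" if "u \<in> U" for u unfolding V using that z by blast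
  moreover have "0 + w \<in> V" if "w \<in> W" for w unfolding V using that z by blast
  ultimately show "U \<subseteq> V" "W \<subseteq> V" by auto
qed

lemma component_decomposition:
  assumes "direct_sum V U W" "x \<in> V"
  shows "component U W x \<in> U" "component W U x \<in> W"
    "component U W x + component W U x = x"
proof -
  obtain u w where uw: "u \<in> U" "w \<in> W" "x = u + w"
    using assms unfolding direct_sum_def by blast
  have "component U W x = u" by (rule component_unique[OF assms(1)]) (use uw in auto)
  moreover have "component W U x = w"
    by (rule component_unique[OF direct_sum_commute[OF assms(1)]]) (use uw in auto)
  ultimately show "component U W x \<in> U" "component W U x \<in> W"
    "component U W x + component W U x = x" using uw by auto
qed

lemma component_left:
  assumes "direct_sum V U W" "x \<in> U"
  shows "component U W x = x"
  by (rule component_unique[OF assms(1)]) (use assms in \<open>auto simp: direct_sum_def subspace_0\<close>)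

lemma component_right:
  assumes "direct_sum V U W" "x \<in> W"
  shows "component U W x = 0"
  by (rule component_unique[OF assms(1)]) (use assms in \<open>auto simp: direct_sum_def subspace_0\<close>)

text \<open>The induction is Gram--Schmidt: a further spanning vector is replaced by its part orthogonal
  to the span of the others. Positivity is assumed on the span alone because the invariant form is
  positive on \<open>m\<close> but may be indefinite on the whole Lie algebra.\<close>

lemma orthogonal_projection_exists:
  fixes B :: "'a::real_vector \<Rightarrow> 'a \<Rightarrow> real"
  assumes B: "bilinear B" and "finite S"
    and pos: "\<And>x. x \<in> span S \<Longrightarrow> x \<noteq> 0 \<Longrightarrow> B x x > 0"
  shows "\<exists>w\<in>span S. \<forall>u\<in>span S. B (x - w) u = 0"
  using \<open>finite S\<close> pos
proof (induction S arbitrary: x rule: finite_induct)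
  case empty
  then show ?case by (auto simp: bilinear_rzero[OF B])
next
  case (insert s S)
  have sub: "span S \<subseteq> span (insert s S)" by (rule span_mono) auto
  have IH: "\<exists>w\<in>span S. \<forall>u\<in>span S. B (y - w) u = 0" for y
    using insert.IH insert.prems sub by blast
  obtain p where p: "p \<in> span S" "\<And>u. u \<in> span S \<Longrightarrow> B (s - p) u = 0" using IH by blast
  obtain q where q: "q \<in> span S" "\<And>u. u \<in> span S \<Longrightarrow> B (x - q) u = 0" using IH by blast
  define t where "t = s - p"
  define c where "c = B (x - q) t / B t t"
  have tin: "t \<in> span (insert s S)"
    unfolding t_def using p(1) sub by (intro span_diff) (auto intro: span_base)
  have c: "B (x - q) t = c * B t t"
  proof (cases "t = 0")
    case True
    then show ?thesis by (simp add: bilinear_rzero[OF B])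
  next
    case False
    then show ?thesis using insert.prems[OF tin] by (simp add: c_def)
  qed
  have "B (x - (q + c *\<^sub>R t)) u = 0" if u_in: "u \<in> span (insert s S)" for u
  proof -
    obtain d where d: "u - d *\<^sub>R s \<in> span S" using u_in unfolding span_insert by blast
    define v where "v = (u - d *\<^sub>R s) + d *\<^sub>R p"
    have v: "v \<in> span S" using d p(1) by (auto simp: v_def intro: span_add span_scale)
    have u: "u = v + d *\<^sub>R t" by (simp add: v_def t_def algebra_simps)
    have "B (x - q) v = 0" "B t v = 0" using q(2) p(2) v by (auto simp: t_def)
    then show ?thesis
      using c by (simp add: u bilinear_radd[OF B] bilinear_rmul[OF B] bilinear_lmul[OF B]
          bilinear_lsub[OF B] bilinear_ladd[OF B] algebra_simps)
  qed
  moreover have "q + c *\<^sub>R t \<in> span (insert s S)"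
    using q(1) sub tin by (auto intro: span_add span_scale)
  ultimately show ?case by blast
qed

lemma orthogonal_complement_direct_sum:
  fixes B :: "'a::real_vector \<Rightarrow> 'a \<Rightarrow> real"
  assumes B: "bilinear B" and sym: "\<And>x y. B x y = B y x"
    and fin: "finite E" "span E = (UNIV :: 'a set)"
    and V: "subspace V" and W: "subspace W" "W \<subseteq> V"
    and pos: "\<And>x. x \<in> V \<Longrightarrow> x \<noteq> 0 \<Longrightarrow> B x x > 0"
  shows "direct_sum V W {y \<in> V. \<forall>w\<in>W. B w y = 0}" (is "direct_sum V W ?P")
proof -
  obtain S where S: "S \<subseteq> W" "independent S" "W \<subseteq> span S" by (rule basis_exists)
  have "finite S" using independent_span_bound[OF fin(1) S(2)] fin(2) by auto
  have span: "span S = W" using S W(1) by (metis span_minimal subset_antisym)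
  have "subspace ?P"
    using V by (auto simp: subspace_def bilinear_rzero[OF B] bilinear_radd[OF B] bilinear_rmul[OF B])
  moreover have "W \<inter> ?P = {0}"
    using pos W V by (force simp: subspace_0 bilinear_rzero[OF B])
  moreover have "V = {u + w |u w. u \<in> W \<and> w \<in> ?P}"
  proof
    show "{u + w |u w. u \<in> W \<and> w \<in> ?P} \<subseteq> V"
      using W V by (auto intro: subspace_add)
    show "V \<subseteq> {u + w |u w. u \<in> W \<and> w \<in> ?P}"
    proof
      fix x assume x: "x \<in> V"
      obtain w where w: "w \<in> W" "\<And>u. u \<in> W \<Longrightarrow> B (x - w) u = 0"
        using orthogonal_projection_exists[OF B \<open>finite S\<close>] pos W unfolding span
        by (meson subsetD)
      have "x - w \<in> V" using x w V W by (auto intro: subspace_diff)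
      then have "x - w \<in> ?P" using w(2) sym by simp
      moreover have "x = w + (x - w)" by simp
      ultimately show "x \<in> {u + w |u w. u \<in> W \<and> w \<in> ?P}" using w(1) by blast
    qed
  qed
  ultimately show ?thesis using W by (simp add: direct_sum_def)
qed


section \<open>Transvection algebras with an invariant form\<close>

locale transvection_decomposition =
  fixes br :: "'a::real_vector \<Rightarrow> 'a \<Rightarrow> 'a" and h m :: "'a set" and g B :: "'a \<Rightarrow> 'a \<Rightarrow> real"
  assumes nat_red: "naturally_reductive br h m g"
    and transvection: "is_transvection_algebra br h m"
    and kostant: "kostant_form br h m g B"
begin

abbreviation "hc \<equiv> component h m"
abbreviation "mc \<equiv> component m h"

lemma br_bilinear: "bilinear br" and br_self [simp]: "br x x = 0"
  and jacobi: "br x (br y z) + br y (br z x) + br z (br x y) = 0"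
  and h_subspace: "subspace h" and br_h: "k \<in> h \<Longrightarrow> l \<in> h \<Longrightarrow> br k l \<in> h"
  and hm: "direct_sum UNIV h m" and br_hm: "k \<in> h \<Longrightarrow> x \<in> m \<Longrightarrow> br k x \<in> m"
  using nat_red unfolding naturally_reductive_def lie_algebra_def lie_subalgebra_def by auto

lemma finite_dimensional: "\<exists>E::'a set. finite E \<and> span E = UNIV"
  using nat_red unfolding naturally_reductive_def lie_algebra_def by auto

lemma B_bilinear: "bilinear B" and B_sym: "B x y = B y x"
  and B_nondegenerate: "(\<And>y. B x y = 0) \<Longrightarrow> x = 0"
  and B_invariant: "B (br x y) z = - B y (br x z)"
  and B_m: "x \<in> m \<Longrightarrow> y \<in> m \<Longrightarrow> B x y = g x y"
  and B_hm: "k \<in> h \<Longrightarrow> x \<in> m \<Longrightarrow> B k x = 0"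
  using kostant unfolding kostant_form_def by (auto simp: eq_neg_iff_add_eq_0)

lemma B_mh: "k \<in> h \<Longrightarrow> x \<in> m \<Longrightarrow> B x k = 0"
  using B_hm B_sym by metis

lemma B_pos: "x \<in> m \<Longrightarrow> x \<noteq> 0 \<Longrightarrow> B x x > 0"
  using nat_red B_m unfolding naturally_reductive_def inner_product_on_def by auto

lemmas br_simps = bilinear_ladd[OF br_bilinear] bilinear_radd[OF br_bilinear]
  bilinear_lmul[OF br_bilinear] bilinear_rmul[OF br_bilinear] bilinear_lzero[OF br_bilinear]
  bilinear_rzero[OF br_bilinear] bilinear_lneg[OF br_bilinear] bilinear_rneg[OF br_bilinear]

lemmas B_simps = bilinear_ladd[OF B_bilinear] bilinear_radd[OF B_bilinear]
  bilinear_lmul[OF B_bilinear] bilinear_rmul[OF B_bilinear] bilinear_lzero[OF B_bilinear]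
  bilinear_rzero[OF B_bilinear] bilinear_lneg[OF B_bilinear] bilinear_rneg[OF B_bilinear]

lemma br_antisym: "br x y = - br y x"
proof -
  have "br (x + y) (x + y) = (br x x + br x y) + (br y x + br y y)"
    unfolding br_simps by (simp add: algebra_simps)
  then have "br x y + br y x = 0" by (simp only: br_self) simp
  then show ?thesis by (simp add: eq_neg_iff_add_eq_0)
qed

lemma br_derivation: "br k (br x y) = br (br k x) y + br x (br k y)"
  using jacobi[of k x y] br_antisym[of y "br k x"] br_antisym[of y k]
  by (simp add: br_simps algebra_simps eq_neg_iff_add_eq_0)

lemma m_subspace: "subspace m"
  using hm by (simp add: direct_sum_def)

lemma hc_mem [simp]: "hc x \<in> h" and mc_mem [simp]: "mc x \<in> m" and hc_mc: "hc x + mc x = x"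
  using component_decomposition[OF hm, of x] by auto

lemma hc_eqI: "k \<in> h \<Longrightarrow> x - k \<in> m \<Longrightarrow> hc x = k"
  by (rule component_unique[OF hm])

lemma mc_eqI: "y \<in> m \<Longrightarrow> x - y \<in> h \<Longrightarrow> mc x = y"
  by (rule component_unique[OF direct_sum_commute[OF hm]])

lemma hc_add: "hc (x + y) = hc x + hc y"
proof (rule hc_eqI)
  have "x + y - (hc x + hc y) = mc x + mc y"
    using hc_mc[of x] hc_mc[of y] by (simp add: algebra_simps)
  then show "x + y - (hc x + hc y) \<in> m" using m_subspace by (simp add: subspace_add)
qed (simp add: h_subspace subspace_add)

lemma mc_add: "mc (x + y) = mc x + mc y"
proof (rule mc_eqI)
  have "x + y - (mc x + mc y) = hc x + hc y"
    using hc_mc[of x] hc_mc[of y] by (simp add: algebra_simps)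
  then show "x + y - (mc x + mc y) \<in> h" using h_subspace by (simp add: subspace_add)
qed (simp add: m_subspace subspace_add)

lemma mc_uminus: "mc (- x) = - mc x"
proof (rule mc_eqI)
  have "- x - - mc x = - hc x" using hc_mc[of x] by (simp add: algebra_simps)
  then show "- x - - mc x \<in> h" using h_subspace by (simp add: subspace_neg)
qed (simp add: m_subspace subspace_neg)

lemma ad_h_components:
  assumes "k \<in> h"
  shows "hc (br k x) = br k (hc x)" "mc (br k x) = br k (mc x)"
proof -
  have e: "br k x = br k (hc x) + br k (mc x)"
    using hc_mc[of x] by (simp flip: br_simps)
  show "hc (br k x) = br k (hc x)" "mc (br k x) = br k (mc x)"
    by (rule hc_eqI mc_eqI; use e assms in \<open>simp add: br_h br_hm\<close>)+
qed

lemma B_mc: "z \<in> m \<Longrightarrow> B (mc x) z = B x z"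
  using hc_mc[of x] B_hm[of "hc x" z] by (metis B_simps(1) add_0 hc_mem)

lemma B_hc: "k \<in> h \<Longrightarrow> B (hc x) k = B x k"
  using hc_mc[of x] B_mh[of k "mc x"] by (metis B_simps(1) add.right_neutral mc_mem)

lemma torsion_form_B: "z \<in> m \<Longrightarrow> torsion_form br h m g x y z = - B (br x y) z"
  using B_m[of "- mc (br x y)" z] B_mc[of z "br x y"] m_subspace
  by (simp add: torsion_form_def torsion_def subspace_neg B_simps)

lemma zero_if_orthogonal_m:
  assumes "x \<in> m" "\<And>z. z \<in> m \<Longrightarrow> B x z = 0"
  shows "x = 0"
  using B_pos[of x] assms by force

lemma zero_if_orthogonal_h:
  assumes "k \<in> h" "\<And>l. l \<in> h \<Longrightarrow> B k l = 0"
  shows "k = 0"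
proof (rule B_nondegenerate)
  fix y
  show "B k y = 0" using hc_mc[of y] assms B_hm[of k "mc y"]
    by (metis B_simps(2) add.right_neutral hc_mem mc_mem)
qed

text \<open>An element orthogonal to \<open>h\<close> has an \<open>h\<close>-part orthogonal to both \<open>h\<close> and \<open>m\<close>. Hence \<open>m\<close> is
  the whole of \<open>h\<^sup>\<bottom>\<close>, although \<open>B\<close> may be indefinite on \<open>h\<close>.\<close>

lemma m_if_orthogonal_h:
  assumes "\<And>k. k \<in> h \<Longrightarrow> B x k = 0"
  shows "x \<in> m"
proof -
  have "hc x = 0" using zero_if_orthogonal_h[of "hc x"] B_hc assms by auto
  then show ?thesis using hc_mc[of x] by (metis add_0 mc_mem)
qed

lemma effective_zero:
  assumes "k \<in> h" "\<And>x. x \<in> m \<Longrightarrow> br k x = 0"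
  shows "k = 0"
proof -
  have "isotropy_ad br m k = isotropy_ad br m 0"
    using assms(2) by (auto simp: isotropy_ad_def br_simps fun_eq_iff)
  moreover have "inj_on (isotropy_ad br m) h"
    using transvection by (simp add: is_transvection_algebra_def effective_def)
  ultimately show ?thesis using assms(1) h_subspace by (meson inj_onD subspace_0)
qed


section \<open>The isotropy generated by a part of the tangent space\<close>

text \<open>When effectiveness is used to identify \<open>h\<close> with its image in \<open>so(m)\<close>, this is the span of the
  curvature operators \<open>R(x,y)\<close> with \<open>x, y \<in> A\<close>.\<close>

definition holonomy :: "'a set \<Rightarrow> 'a set" where
  "holonomy A = span {hc (br x y) | x y. x \<in> A \<and> y \<in> A}"

lemma holonomy_subspace: "subspace (holonomy A)"
  by (simp add: holonomy_def)

lemma holonomy_generator: "x \<in> A \<Longrightarrow> y \<in> A \<Longrightarrow> hc (br x y) \<in> holonomy A"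
  unfolding holonomy_def by (rule span_base) blast

lemma holonomy_minimal:
  assumes "subspace S" "\<And>x y. x \<in> A \<Longrightarrow> y \<in> A \<Longrightarrow> hc (br x y) \<in> S"
  shows "holonomy A \<subseteq> S"
  unfolding holonomy_def by (rule span_minimal) (use assms in auto)

lemma holonomy_le_h: "holonomy A \<subseteq> h"
  using h_subspace by (intro holonomy_minimal) auto

text \<open>The condition \<open>im(R) = ad(h)\<close> is about operators on \<open>m\<close>; effectiveness transports it to
  \<open>h\<close> itself.\<close>

lemma holonomy_m: "holonomy m = h"
proof
  show "h \<subseteq> holonomy m"
  proof
    fix k assume k: "k \<in> h"
    interpret fs: vector_space "fun_scale :: real \<Rightarrow> ('a \<Rightarrow> 'a) \<Rightarrow> 'a \<Rightarrow> 'a"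
      by (rule vector_space_fun_scale)
    let ?ad = "isotropy_ad br m"
    have inj: "inj_on ?ad h" and im: "curvature_image br h m = ?ad ` h"
      using transvection by (auto simp: is_transvection_algebra_def effective_def)
    have add: "?ad (k + l) = ?ad k + ?ad l" for k l
      by (auto simp: isotropy_ad_def fun_eq_iff br_simps)
    have scale: "?ad (c *\<^sub>R k) = fun_scale c (?ad k)" for c k
      by (auto simp: isotropy_ad_def fun_eq_iff br_simps fun_scale_def)
    have neg: "?ad (- k) = - ?ad k" for k
      by (auto simp: isotropy_ad_def fun_eq_iff br_simps)
    have zero: "?ad 0 = 0"
      by (auto simp: isotropy_ad_def fun_eq_iff br_simps)
    have "fs.span {curvature br h m x y | x y. x \<in> m \<and> y \<in> m} \<subseteq> ?ad ` holonomy m"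
    proof (rule fs.span_minimal)
      show "{curvature br h m x y | x y. x \<in> m \<and> y \<in> m} \<subseteq> ?ad ` holonomy m"
        using holonomy_generator[of _ m] subspace_neg[OF holonomy_subspace]
        by (auto simp: curvature_def simp flip: neg)
      show "fs.subspace (?ad ` holonomy m)"
        unfolding fs.subspace_def
        using subspace_0[OF holonomy_subspace] subspace_add[OF holonomy_subspace]
          subspace_scale[OF holonomy_subspace]
        by (auto simp flip: add scale) (metis image_eqI zero)
    qed
    then have "?ad k \<in> ?ad ` holonomy m"
      using im k by (auto simp: curvature_image_def)
    then show "k \<in> holonomy m"
      using inj k holonomy_le_h by (auto dest!: inj_onD)
  qed
qed (rule holonomy_le_h)

lemma holonomy_ad_invariant:
  assumes k: "k \<in> h" and A: "\<And>x. x \<in> A \<Longrightarrow> br k x \<in> A" and l: "l \<in> holonomy A"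
  shows "br k l \<in> holonomy A"
proof -
  have "subspace {l. br k l \<in> holonomy A}"
    using holonomy_subspace[of A] by (auto simp: subspace_def br_simps)
  moreover have "br k (hc (br x y)) \<in> holonomy A" if "x \<in> A" "y \<in> A" for x y
  proof -
    have "br k (hc (br x y)) = hc (br (br k x) y) + hc (br x (br k y))"
      using ad_h_components(1)[OF k, of "br x y"] by (simp only: br_derivation[of k x y] hc_add)
    then show ?thesis
      using that A holonomy_generator by (simp add: holonomy_subspace subspace_add)
  qed
  ultimately show ?thesis using holonomy_minimal[of "{l. br k l \<in> holonomy A}" A] l by auto
qed


section \<open>From invariant commuting parts of the tangent space to ideals\<close>

definition commuting_splitting :: "'a set \<Rightarrow> 'a set \<Rightarrow> bool" where
  "commuting_splitting a b \<longleftrightarrow>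
     direct_sum m a b \<and>
     (\<forall>x\<in>a. \<forall>y\<in>b. B x y = 0 \<and> br x y = 0) \<and>
     (\<forall>k\<in>h. (\<forall>x\<in>a. br k x \<in> a) \<and> (\<forall>y\<in>b. br k y \<in> b)) \<and>
     (\<forall>x\<in>a. \<forall>y\<in>a. mc (br x y) \<in> a) \<and> (\<forall>x\<in>b. \<forall>y\<in>b. mc (br x y) \<in> b)"

definition factor :: "'a set \<Rightarrow> 'a set" where
  "factor a = {k + x | k x. k \<in> holonomy a \<and> x \<in> a}"

lemma commuting_splitting_commute: "commuting_splitting a b \<Longrightarrow> commuting_splitting b a"
proof -
  assume s: "commuting_splitting a b"
  have "B y x = 0 \<and> br y x = 0" if "x \<in> a" "y \<in> b" for x y
    using s that B_sym[of y x] br_antisym[of y x] by (simp add: commuting_splitting_def)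
  then show ?thesis using s direct_sum_commute unfolding commuting_splitting_def by blast
qed

text \<open>Let \<open>u, v \<in> a\<close>. Since \<open>u\<close> and \<open>v\<close> commute with \<open>b\<close>, so does \<open>[u,v]\<close> by the Jacobi identity.
  Its \<open>m\<close>-part lies in \<open>a\<close> and commutes with \<open>b\<close> as well, which leaves the \<open>h\<close>-part.\<close>

lemma holonomy_kills:
  assumes s: "commuting_splitting a b" and k: "k \<in> holonomy a" and y: "y \<in> b"
  shows "br k y = 0"
proof -
  have "subspace {k. br k y = 0}" by (auto simp: subspace_def br_simps)
  moreover have "br (hc (br u v)) y = 0" if uv: "u \<in> a" "v \<in> a" for u v
  proof -
    have "br (hc (br u v)) y + br (mc (br u v)) y = br (br u v) y"
      using hc_mc[of "br u v"] by (simp flip: br_simps)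
    moreover have "br (mc (br u v)) y = 0" "br u y = 0" "br v y = 0" "br y u = 0"
      using s uv y br_antisym[of y u] by (auto simp: commuting_splitting_def)
    moreover have "br (br u v) y = 0"
      using jacobi[of u v y] calculation br_antisym[of "br u v" y] by (simp add: br_simps)
    ultimately show ?thesis by simp
  qed
  ultimately show ?thesis using holonomy_minimal[of "{k. br k y = 0}" a] k by auto
qed

lemma factor_ideal:
  assumes s: "commuting_splitting a b"
  shows "lie_ideal br (factor a)"
  unfolding lie_ideal_def
proof (intro conjI allI ballI)
  have ds: "direct_sum m a b" using s by (simp add: commuting_splitting_def)
  then have a: "subspace a" by (simp add: direct_sum_def)
  show sub: "subspace (factor a)"
    unfolding factor_def by (rule subspace_sums[OF holonomy_subspace a])
  have in1: "k \<in> factor a" if "k \<in> holonomy a" for k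
    using that subspace_0[OF a] unfolding factor_def by force
  have in2: "x \<in> factor a" if "x \<in> a" for x
    using that subspace_0[OF holonomy_subspace] unfolding factor_def by force
  fix v w assume "w \<in> factor a"
  then obtain k z where w: "w = k + z" "k \<in> holonomy a" "z \<in> a" by (auto simp: factor_def)
  obtain x y where xy: "x \<in> a" "y \<in> b" "mc v = x + y"
    using ds mc_mem[of v] unfolding direct_sum_def by blast
  have v: "v = hc v + x + y" using hc_mc[of v] xy(3) by (simp add: algebra_simps)
  have k: "k \<in> h" using w(2) holonomy_le_h by auto
  have inv: "\<And>l u. l \<in> h \<Longrightarrow> u \<in> a \<Longrightarrow> br l u \<in> a" using s by (auto simp: commuting_splitting_def)
  have "br (hc v) k \<in> factor a" using holonomy_ad_invariant[of "hc v" a k] inv w(2) in1 by auto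
  moreover have "br (hc v) z \<in> factor a" using inv w(3) in2 by auto
  moreover have "br x k \<in> factor a"
    using inv[OF k xy(1)] br_antisym[of x k] in2 subspace_neg[OF a] by auto
  moreover have "br x z \<in> factor a"
  proof -
    have "mc (br x z) \<in> a" using s xy(1) w(3) by (auto simp: commuting_splitting_def)
    then show ?thesis unfolding factor_def
      using holonomy_generator[OF xy(1) w(3)] hc_mc[of "br x z"] by force
  qed
  moreover have "br y k = 0" using holonomy_kills[OF s w(2) xy(2)] br_antisym[of y k] by simp
  moreover have "br y z = 0"
    using s w(3) xy(2) br_antisym[of y z] by (auto simp: commuting_splitting_def)
  moreover have "br v w = br (hc v) k + br (hc v) z + br x k + br x z + br y k + br y z"
    unfolding w(1) by (subst v) (simp add: br_simps algebra_simps)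
  ultimately show "br v w \<in> factor a" using sub by (simp add: subspace_add)
qed

text \<open>The isotropy algebra is spanned by the \<open>[x,y]\<^sub>h\<close>, and the mixed ones vanish; an element
  in both parts kills all of \<open>m\<close>, hence is zero by effectiveness.\<close>

lemma holonomy_direct_sum:
  assumes s: "commuting_splitting a b"
  shows "direct_sum h (holonomy a) (holonomy b)"
proof -
  have ds: "direct_sum m a b" using s by (simp add: commuting_splitting_def)
  have comm: "br x y = 0 \<and> br y x = 0" if "x \<in> a" "y \<in> b" for x y
    using s that br_antisym[of y x] by (simp add: commuting_splitting_def)
  have "k = 0" if k: "k \<in> holonomy a" "k \<in> holonomy b" for k
  proof (rule effective_zero)
    show "k \<in> h" using k holonomy_le_h by auto
    fix x assume "x \<in> m"
    then obtain u v where "u \<in> a" "v \<in> b" "x = u + v" using ds unfolding direct_sum_def by blast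
    then show "br k x = 0"
      using holonomy_kills[OF s k(1)] holonomy_kills[OF commuting_splitting_commute[OF s] k(2)]
      by (simp add: br_simps)
  qed
  moreover have "holonomy m \<subseteq> {u + w |u w. u \<in> holonomy a \<and> w \<in> holonomy b}"
  proof (rule holonomy_minimal)
    show "subspace {u + w |u w. u \<in> holonomy a \<and> w \<in> holonomy b}"
      by (rule subspace_sums[OF holonomy_subspace holonomy_subspace])
    fix x y assume "x \<in> m" "y \<in> m"
    then obtain u v u' v' where uv: "u \<in> a" "v \<in> b" "x = u + v" "u' \<in> a" "v' \<in> b" "y = u' + v'"
      using ds unfolding direct_sum_def by blast
    then have "hc (br x y) = hc (br u u') + hc (br v v')"
      using comm by (simp add: br_simps hc_add)
    then show "hc (br x y) \<in> {u + w |u w. u \<in> holonomy a \<and> w \<in> holonomy b}"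
      using uv holonomy_generator by blast
  qed
  moreover have "{u + w |u w. u \<in> holonomy a \<and> w \<in> holonomy b} \<subseteq> h"
    using holonomy_le_h h_subspace by (auto intro: subspace_add)
  ultimately show ?thesis
    using holonomy_subspace by (auto simp: direct_sum_def holonomy_m subspace_0)
qed

lemma factor_direct_sum:
  assumes s: "commuting_splitting a b"
  shows "direct_sum UNIV (factor a) (factor b)"
proof -
  have ds: "direct_sum m a b" using s by (simp add: commuting_splitting_def)
  have dh: "direct_sum h (holonomy a) (holonomy b)" by (rule holonomy_direct_sum[OF s])
  have am: "a \<subseteq> m" "b \<subseteq> m" using direct_sum_parts[OF ds] by auto
  have "subspace (factor a)" "subspace (factor b)"
    using factor_ideal[OF s] factor_ideal[OF commuting_splitting_commute[OF s]]
    by (auto simp: lie_ideal_def)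
  moreover have "v = 0" if vab: "v \<in> factor a" "v \<in> factor b" for v
  proof -
    obtain k x l y where v: "v = k + x" "v = l + y"
      and mem: "k \<in> holonomy a" "x \<in> a" "l \<in> holonomy b" "y \<in> b"
      using vab unfolding factor_def by blast
    have "hc v = k" by (rule hc_eqI) (use v(1) mem am holonomy_le_h in auto)
    moreover have "hc v = l" by (rule hc_eqI) (use v(2) mem am holonomy_le_h in auto)
    ultimately have "k = l" "x = y" using v by auto
    then have "k = 0" "x = 0" using mem ds dh by (auto simp: direct_sum_def)
    then show ?thesis using v by simp
  qed
  moreover have "\<exists>p q. v = p + q \<and> p \<in> factor a \<and> q \<in> factor b" for v
  proof -
    obtain x y where xy: "x \<in> a" "y \<in> b" "mc v = x + y"
      using ds mc_mem[of v] unfolding direct_sum_def by blast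
    obtain k l where kl: "k \<in> holonomy a" "l \<in> holonomy b" "hc v = k + l"
      using dh hc_mem[of v] unfolding direct_sum_def by blast
    have "v = (k + x) + (l + y)" using hc_mc[of v] xy kl by (simp add: algebra_simps)
    then show ?thesis using xy kl unfolding factor_def by blast
  qed
  ultimately show ?thesis by (auto simp: direct_sum_def subspace_0)
qed

text \<open>By invariance \<open>B([x,y]\<^sub>h,l) = -B(y,[x,l])\<close>, and the isotropy generated by \<open>b\<close> kills
  \<open>x \<in> a\<close>.\<close>

lemma holonomy_orthogonal:
  assumes s: "commuting_splitting a b" and k: "k \<in> holonomy a" and l: "l \<in> holonomy b"
  shows "B k l = 0"
proof -
  have "l \<in> h" using l holonomy_le_h by auto
  have "subspace {k. B k l = 0}" by (auto simp: subspace_def B_simps)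
  moreover have "B (hc (br x y)) l = 0" if "x \<in> a" "y \<in> a" for x y
  proof -
    have "br x l = 0"
      using holonomy_kills[OF commuting_splitting_commute[OF s] l that(1)] br_antisym[of x l] by simp
    then show ?thesis using \<open>l \<in> h\<close> by (simp add: B_hc B_invariant B_simps)
  qed
  ultimately show ?thesis using holonomy_minimal[of "{k. B k l = 0}" a] k by auto
qed

lemma factor_orthogonal:
  assumes s: "commuting_splitting a b" and "v \<in> factor a" "w \<in> factor b"
  shows "B v w = 0"
proof -
  have am: "a \<subseteq> m" "b \<subseteq> m"
    using s direct_sum_parts[of m a b] by (auto simp: commuting_splitting_def)
  obtain k x l y where v: "v = k + x" "w = l + y"
    and mem: "k \<in> holonomy a" "x \<in> a" "l \<in> holonomy b" "y \<in> b"
    using assms unfolding factor_def by blast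
  have "B k l = 0" by (rule holonomy_orthogonal[OF s mem(1,3)])
  moreover have "B k y = 0" "B x l = 0"
    using mem am holonomy_le_h B_hm[of k y] B_mh[of l x] by blast+
  moreover have "B x y = 0" using s mem by (auto simp: commuting_splitting_def)
  ultimately show ?thesis by (simp add: v B_simps)
qed

definition ideal_splitting :: bool where
  "ideal_splitting \<longleftrightarrow>
    (\<exists>g1 g2. lie_ideal br g1 \<and> lie_ideal br g2 \<and> g1 \<noteq> {0} \<and> g2 \<noteq> {0} \<and>
       (\<forall>x\<in>g1. \<forall>y\<in>g2. B x y = 0) \<and>
       direct_sum UNIV g1 g2 \<and>
       (\<exists>h1 h2. direct_sum h h1 h2 \<and> h1 \<subseteq> g1 \<and> h2 \<subseteq> g2))"

lemma factor_superset:
  assumes "commuting_splitting a b"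
  shows "a \<subseteq> factor a" "holonomy a \<subseteq> factor a"
proof -
  have "0 \<in> a" "0 \<in> holonomy a"
    using assms holonomy_subspace by (auto simp: commuting_splitting_def direct_sum_def subspace_0)
  then show "a \<subseteq> factor a" "holonomy a \<subseteq> factor a" unfolding factor_def by force+
qed

lemma ideal_splitting_if_commuting_splitting:
  assumes s: "commuting_splitting a b" and "a \<noteq> {0}" "b \<noteq> {0}"
  shows ideal_splitting
proof -
  note s' = commuting_splitting_commute[OF s]
  have "0 \<in> a" "0 \<in> b" using s by (auto simp: commuting_splitting_def direct_sum_def subspace_0)
  then have "factor a \<noteq> {0}" "factor b \<noteq> {0}"
    using assms factor_superset[OF s] factor_superset[OF s'] by auto
  then show ?thesis
    unfolding ideal_splitting_def
    using factor_ideal[OF s] factor_ideal[OF s'] factor_orthogonal[OF s] factor_direct_sum[OF s]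
      holonomy_direct_sum[OF s] factor_superset(2)[OF s] factor_superset(2)[OF s'] by blast
qed


section \<open>Subspaces invariant under the isotropy and the torsion\<close>

text \<open>Mixed brackets \<open>[x,y]\<close> with \<open>x \<in> W\<close> and \<open>y \<in> W\<^sup>\<bottom>\<close> vanish. Their \<open>m\<close>-part is zero since the
  torsion is totally skew and preserves \<open>W\<close>. Their \<open>h\<close>-part is orthogonal to every
  \<open>[z,w]\<^sub>h\<close>, because pairing with it gives \<open>B([[z,w]\<^sub>h,x],y)\<close> and \<open>W\<close> is isotropy invariant; those
  elements span \<open>h\<close>, on which \<open>B\<close> is non-degenerate.\<close>

lemma commuting_splitting_of_invariant_subspace:
  assumes W: "subspace W" "W \<subseteq> m"
    and ad: "\<And>k x. k \<in> h \<Longrightarrow> x \<in> W \<Longrightarrow> br k x \<in> W"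
    and tor: "\<And>x y. x \<in> W \<Longrightarrow> y \<in> m \<Longrightarrow> mc (br x y) \<in> W"
  shows "commuting_splitting W {y \<in> m. \<forall>w\<in>W. B w y = 0}" (is "commuting_splitting W ?P")
proof -
  obtain E :: "'a set" where E: "finite E" "span E = UNIV" using finite_dimensional by blast
  have ds: "direct_sum m W ?P"
    by (rule orthogonal_complement_direct_sum[OF B_bilinear B_sym E m_subspace W B_pos])
  have adP: "br k y \<in> ?P" if "k \<in> h" "y \<in> ?P" for k y
  proof -
    have "B w (br k y) = - B (br k w) y" for w using B_invariant[of k w y] by simp
    then show ?thesis using that ad br_hm by auto
  qed
  have torP: "mc (br y z) \<in> ?P" if yz: "y \<in> ?P" "z \<in> m" for y z
  proof -
    have "B w (mc (br y z)) = 0" if w: "w \<in> W" for w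
    proof -
      have "B w (mc (br y z)) = B (br y z) w"
        using B_mc[of w "br y z"] W w B_sym[of w "mc (br y z)"] by auto
      also have "\<dots> = - B (br z y) w" by (subst br_antisym) (simp add: B_simps)
      also have "\<dots> = B (br z w) y"
        using B_invariant[of z y w] B_sym[of y "br z w"] by simp
      also have "\<dots> = - B (br w z) y" by (subst br_antisym) (simp add: B_simps)
      also have "\<dots> = - B (mc (br w z)) y" using yz by (simp add: B_mc)
      also have "\<dots> = 0" using tor[OF w yz(2)] yz(1) by simp
      finally show ?thesis .
    qed
    then show ?thesis by simp
  qed
  have comm: "br x y = 0" if x: "x \<in> W" and y: "y \<in> ?P" for x y
  proof -
    have "mc (br y x) \<in> ?P" using torP y x W by blast
    then have "mc (br x y) \<in> ?P"
      using ds unfolding direct_sum_def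
      by (subst br_antisym) (simp add: mc_uminus subspace_neg del: mem_Collect_eq)
    moreover have "mc (br x y) \<in> W" using tor x y by simp
    ultimately have mz: "mc (br x y) = 0" using ds unfolding direct_sum_def by blast
    have "holonomy m \<subseteq> {l. B (br x y) l = 0}"
    proof (rule holonomy_minimal)
      show "subspace {l. B (br x y) l = 0}" by (auto simp: subspace_def B_simps)
      fix z w
      let ?k = "hc (br z w)"
      have "B (br x y) ?k = - B y (br x ?k)" by (rule B_invariant)
      also have "\<dots> = B (br ?k x) y" by (subst br_antisym) (simp add: B_simps B_sym)
      also have "\<dots> = 0" using ad[of ?k x] x y by simp
      finally show "?k \<in> {l. B (br x y) l = 0}" by simp
    qed
    then have "hc (br x y) = 0"
      using zero_if_orthogonal_h[of "hc (br x y)"] B_hc holonomy_m by auto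
    then show ?thesis using mz hc_mc[of "br x y"] by simp
  qed
  have "\<forall>x\<in>W. \<forall>y\<in>W. mc (br x y) \<in> W" using tor W by blast
  moreover have "\<forall>x\<in>?P. \<forall>y\<in>?P. mc (br x y) \<in> ?P" using torP by blast
  moreover have "\<forall>k\<in>h. (\<forall>x\<in>W. br k x \<in> W) \<and> (\<forall>y\<in>?P. br k y \<in> ?P)" using ad adP by blast
  moreover have "\<forall>x\<in>W. \<forall>y\<in>?P. B x y = 0 \<and> br x y = 0" using comm by blast
  ultimately show ?thesis using ds unfolding commuting_splitting_def by blast
qed

lemma ideal_splitting_of_invariant_subspace:
  assumes W: "subspace W" "W \<subseteq> m" "W \<noteq> {0}" "W \<noteq> m"
    and ad: "\<And>k x. k \<in> h \<Longrightarrow> x \<in> W \<Longrightarrow> br k x \<in> W"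
    and tor: "\<And>x y. x \<in> W \<Longrightarrow> y \<in> m \<Longrightarrow> mc (br x y) \<in> W"
  shows ideal_splitting
proof -
  note s = commuting_splitting_of_invariant_subspace[OF W(1,2) ad tor]
  have "{y \<in> m. \<forall>w\<in>W. B w y = 0} \<noteq> {0}"
  proof
    assume P: "{y \<in> m. \<forall>w\<in>W. B w y = 0} = {0}"
    have "m = {u + w |u w. u \<in> W \<and> w \<in> {y \<in> m. \<forall>w\<in>W. B w y = 0}}"
      using s by (simp add: commuting_splitting_def direct_sum_def)
    then have "m = W" unfolding P by simp
    then show False using W by simp
  qed
  then show ?thesis using ideal_splitting_if_commuting_splitting[OF s W(3)] by simp
qed

text \<open>The part of \<open>m1\<close> spanned by the torsion is isotropy invariant, although \<open>m1\<close> itself need not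
  be: the isotropy acts by derivations of \<open>T\<close>, and \<open>T(m,m1) = T(m1,m1)\<close>. What is lost from
  \<open>m1\<close> lies in the kernel of \<open>T\<close> and goes into the complementary factor.\<close>

lemma ideal_splitting_of_torsion_splitting:
  assumes ds: "direct_sum m m1 m2" and orth: "\<And>x y. x \<in> m1 \<Longrightarrow> y \<in> m2 \<Longrightarrow> B x y = 0"
    and m2: "m2 \<noteq> {0}"
    and mixed: "\<And>x y. x \<in> m1 \<Longrightarrow> y \<in> m2 \<Longrightarrow> mc (br x y) = 0"
    and nz: "p \<in> m1" "q \<in> m1" "mc (br p q) \<noteq> 0"
  shows ideal_splitting
proof -
  define W where "W = span {mc (br x y) | x y. x \<in> m1 \<and> y \<in> m1}"
  have sub: "subspace m1" "subspace m2" "m1 \<inter> m2 = {0}" and le: "m1 \<subseteq> m" "m2 \<subseteq> m"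
    using ds direct_sum_parts[OF ds] by (auto simp: direct_sum_def)
  have gen: "mc (br x y) \<in> W" if "x \<in> m1" "y \<in> m1" for x y
    unfolding W_def using that by (blast intro: span_base)
  have genm: "mc (br x y) \<in> W" if x: "x \<in> m1" and "y \<in> m" for x y
  proof -
    obtain y1 y2 where y: "y1 \<in> m1" "y2 \<in> m2" "y = y1 + y2"
      using ds \<open>y \<in> m\<close> unfolding direct_sum_def by blast
    then have "mc (br x y) = mc (br x y1)" using mixed[OF x] by (simp add: br_simps mc_add)
    then show ?thesis using gen x y by simp
  qed
  have Wsub: "subspace W" by (simp add: W_def)
  have Wm1: "W \<subseteq> m1"
    unfolding W_def
  proof (rule span_minimal[OF _ sub(1)], clarify)
    fix x y assume xy: "x \<in> m1" "y \<in> m1"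
    obtain u v where uv: "u \<in> m1" "v \<in> m2" "mc (br x y) = u + v"
      using ds mc_mem[of "br x y"] unfolding direct_sum_def by blast
    have vm: "v \<in> m" using uv le by auto
    have "B (u + v) v = B (br x y) v" using B_mc[OF vm] uv by metis
    also have "\<dots> = - B y (br x v)" by (rule B_invariant)
    also have "\<dots> = - B (mc (br x v)) y" using B_mc[of y "br x v"] xy le B_sym[of y "br x v"] by auto
    also have "\<dots> = 0" using mixed[OF xy(1) uv(2)] by (simp add: B_simps)
    finally have "B v v = 0" using orth[OF uv(1,2)] by (simp add: B_simps)
    then have "v = 0" using B_pos[OF vm] by force
    then show "mc (br x y) \<in> m1" using uv by simp
  qed
  show ?thesis
  proof (rule ideal_splitting_of_invariant_subspace[of W])
    show "W \<subseteq> m" using Wm1 le by blast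
    show "W \<noteq> {0}" using gen nz by blast
    show "W \<noteq> m" using Wm1 le sub m2 subspace_0[OF sub(2)] by blast
    show "mc (br x y) \<in> W" if "x \<in> W" "y \<in> m" for x y using genm that Wm1 by blast
    show "br k x \<in> W" if k: "k \<in> h" and x: "x \<in> W" for k x
    proof -
      have "W \<subseteq> {x. br k x \<in> W}"
        unfolding W_def
      proof (rule span_minimal, clarify, fold W_def)
        show "subspace {x. br k x \<in> W}" using Wsub by (auto simp: subspace_def br_simps)
        fix x y assume xy: "x \<in> m1" "y \<in> m1"
        have "mc (br (br k x) y) = - mc (br y (br k x))"
          by (subst br_antisym) (simp add: mc_uminus)
        then have "mc (br (br k x) y) \<in> W"
          using genm[OF xy(2)] br_hm[OF k] xy le Wsub by (auto intro: subspace_neg)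
        moreover have "mc (br x (br k y)) \<in> W"
          using genm[OF xy(1)] br_hm[OF k] xy le by blast
        moreover have "br k (mc (br x y)) = mc (br (br k x) y) + mc (br x (br k y))"
          using ad_h_components(2)[OF k, of "br x y"] by (simp only: br_derivation[of k x y] mc_add)
        ultimately show "br k (mc (br x y)) \<in> W" using Wsub by (simp add: subspace_add)
      qed
      then show ?thesis using x by blast
    qed
  qed (rule Wsub)
qed


section \<open>The two implications\<close>

lemma two_le_dim_m:
  assumes ds: "direct_sum m m1 m2" and "m1 \<noteq> {0}" "m2 \<noteq> {0}"
  shows "dim m \<ge> 2"
proof -
  have s: "subspace m1" "subspace m2" "m1 \<inter> m2 = {0}" and le: "m1 \<subseteq> m" "m2 \<subseteq> m"
    using ds direct_sum_parts[OF ds] by (auto simp: direct_sum_def)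
  obtain x y where xy: "x \<in> m1" "x \<noteq> 0" "y \<in> m2" "y \<noteq> 0"
    using assms s subspace_0 by blast
  have "x \<notin> span {y}"
    using xy s span_minimal[of "{y}" m2] by blast
  then have ind: "independent {x, y}" using xy by (simp add: independent_insert)
  have "x \<noteq> y" using xy s by blast
  obtain S where S: "S \<subseteq> m" "independent S" "m \<subseteq> span S" "card S = dim m"
    by (rule basis_exists)
  obtain E :: "'a set" where E: "finite E" "span E = UNIV" using finite_dimensional by blast
  have "finite S" using independent_span_bound[OF E(1) S(2)] E(2) by auto
  then have "card {x, y} \<le> card S"
    using independent_span_bound[OF _ ind, of S] xy le S(3) by blast
  then show ?thesis using \<open>x \<noteq> y\<close> S(4) by simp
qed

lemma linear_form_on_zero: "linear_form_on W f \<Longrightarrow> 0 \<in> W \<Longrightarrow> f 0 = 0"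
  unfolding linear_form_on_def by (metis mult_zero_left scale_zero_left)

lemma ideal_splitting_if_reducible:
  assumes red: "reducible br h m g" and nis: "\<not> irreducible_symmetric br h m"
  shows ideal_splitting
proof -
  obtain m1 m2 T1 T2 where ds: "direct_sum m m1 m2" and
    orth: "\<And>x y. x \<in> m1 \<Longrightarrow> y \<in> m2 \<Longrightarrow> g x y = 0" and nz: "m1 \<noteq> {0}" "m2 \<noteq> {0}" and
    T1: "three_form_on m1 T1" and T2: "three_form_on m2 T2" and
    T: "\<And>x y z. x \<in> m \<Longrightarrow> y \<in> m \<Longrightarrow> z \<in> m \<Longrightarrow> torsion_form br h m g x y z =
             T1 (component m1 m2 x) (component m1 m2 y) (component m1 m2 z) +
             T2 (component m2 m1 x) (component m2 m1 y) (component m2 m1 z)"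
    using red unfolding reducible_def by blast
  note ds' = direct_sum_commute[OF ds]
  have le: "m1 \<subseteq> m" "m2 \<subseteq> m" and z: "0 \<in> m1" "0 \<in> m2"
    using direct_sum_parts[OF ds] ds by (auto simp: direct_sum_def subspace_0)
  have orthB: "B x y = 0" if "x \<in> m1" "y \<in> m2" for x y
    using that orth le B_m[of x y] by auto
  have mixed: "mc (br x y) = 0" if x: "x \<in> m1" and y: "y \<in> m2" for x y
  proof (rule zero_if_orthogonal_m)
    fix z assume zm: "z \<in> m"
    have c: "component m1 m2 z \<in> m1" "component m2 m1 z \<in> m2"
      using component_decomposition[OF ds zm] by auto
    have "torsion_form br h m g x y z = T1 x 0 (component m1 m2 z) + T2 0 y (component m2 m1 z)"
      using T[of x y z] x y zm le component_left[OF ds x] component_right[OF ds y]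
        component_left[OF ds' y] component_right[OF ds' x] by auto
    also have "T1 x 0 (component m1 m2 z) = 0"
      using T1 x c z linear_form_on_zero[of m1 "\<lambda>y. T1 x y (component m1 m2 z)"]
      by (simp add: three_form_on_def)
    also have "T2 0 y (component m2 m1 z) = 0"
      using T2 y c z linear_form_on_zero[of m2 "\<lambda>x. T2 x y (component m2 m1 z)"]
      by (simp add: three_form_on_def)
    finally show "B (mc (br x y)) z = 0" using zm by (simp add: torsion_form_B B_mc)
  qed simp
  have orthB': "B y x = 0" if "x \<in> m1" "y \<in> m2" for x y
    using orthB[OF that] B_sym[of y x] by simp
  have mixed': "mc (br y x) = 0" if "x \<in> m1" "y \<in> m2" for x y
    using mixed[OF that] br_antisym[of y x] by (simp add: mc_uminus)
  consider p q where "p \<in> m1" "q \<in> m1" "mc (br p q) \<noteq> 0"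
    | p q where "p \<in> m2" "q \<in> m2" "mc (br p q) \<noteq> 0"
    | "\<And>p q. p \<in> m1 \<Longrightarrow> q \<in> m1 \<Longrightarrow> mc (br p q) = 0" "\<And>p q. p \<in> m2 \<Longrightarrow> q \<in> m2 \<Longrightarrow> mc (br p q) = 0"
    by blast
  then show ?thesis
  proof cases
    case 1
    then show ?thesis using ideal_splitting_of_torsion_splitting[OF ds orthB nz(2) mixed] by blast
  next
    case 2
    then show ?thesis
      by (intro ideal_splitting_of_torsion_splitting[OF ds' _ nz(1), of p q])
        (use mixed' orthB' in auto)
  next
    case 3
    \<comment> \<open>Now \<open>T = 0\<close>: the given splitting carries no information, and an isotropy invariant subspace
      comes from the failure of irreducibility.\<close>
    have T0: "mc (br x y) = 0" if xy: "x \<in> m" "y \<in> m" for x y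
    proof -
      obtain u v u' v' where uv: "u \<in> m1" "v \<in> m2" "x = u + v" "u' \<in> m1" "v' \<in> m2" "y = u' + v'"
        using ds xy unfolding direct_sum_def by blast
      then show ?thesis using 3 mixed mixed' by (simp add: br_simps mc_add)
    qed
    have "\<forall>x\<in>m. \<forall>y\<in>m. torsion br h m x y = 0" using T0 by (simp add: torsion_def)
    with nis two_le_dim_m[OF ds nz] obtain W where W: "subspace W" "W \<subseteq> m" "W \<noteq> {0}" "W \<noteq> m"
      "\<And>k x. k \<in> h \<Longrightarrow> x \<in> W \<Longrightarrow> br k x \<in> W"
      unfolding irreducible_symmetric_def by blast
    show ?thesis
      by (rule ideal_splitting_of_invariant_subspace[OF W])
        (use T0 W in \<open>auto simp: subspace_0\<close>)
  qed
qed

text \<open>\<open>m\<close> is the orthogonal complement of \<open>h\<close>, so it inherits the splitting of \<open>h\<close>. A factor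
  without tangent part would consist of isotropy acting trivially on \<open>m\<close>.\<close>

lemma reducible_if_ideal_splitting:
  assumes ideal_splitting
  shows "reducible br h m g"
proof -
  obtain g1 g2 h1 h2 where I: "lie_ideal br g1" "lie_ideal br g2" and nz: "g1 \<noteq> {0}" "g2 \<noteq> {0}"
    and orth: "\<And>x y. x \<in> g1 \<Longrightarrow> y \<in> g2 \<Longrightarrow> B x y = 0"
    and ds: "direct_sum UNIV g1 g2" and dh: "direct_sum h h1 h2" and le: "h1 \<subseteq> g1" "h2 \<subseteq> g2"
    using assms unfolding ideal_splitting_def
    by (elim exE conjE) (rule that; (assumption | simp))
  have s: "subspace g1" "subspace g2" "g1 \<inter> g2 = {0}" using ds by (auto simp: direct_sum_def)
  have comm: "br x y = 0" "br y x = 0" if "x \<in> g1" "y \<in> g2" for x y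
  proof -
    have "br x y \<in> g2" "br y x \<in> g1" using I that by (auto simp: lie_ideal_def)
    moreover have "br x y \<in> g1"
      using calculation(2) subspace_neg[OF s(1), of "br y x"] br_antisym[of x y] by simp
    ultimately show "br x y = 0" using s by auto
    then show "br y x = 0" using br_antisym[of y x] by simp
  qed
  let ?m1 = "g1 \<inter> m" and ?m2 = "g2 \<inter> m"
  \<comment> \<open>For \<open>k = k1 + k2\<close> in \<open>h1 \<oplus> h2\<close> one has \<open>B(u,k) = B(u,k1) = B(u + v,k1) = 0\<close>.\<close>
  have split: "u \<in> m \<and> v \<in> m" if "u \<in> g1" "v \<in> g2" "u + v \<in> m" for u v
  proof -
    have "u \<in> m"
    proof (rule m_if_orthogonal_h)
      fix k assume "k \<in> h"
      then obtain k1 k2 where k: "k1 \<in> h1" "k2 \<in> h2" "k = k1 + k2"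
        using dh unfolding direct_sum_def by blast
      have k1: "k1 \<in> h" using direct_sum_parts[OF dh] k by auto
      have "B (u + v) k1 = 0" using B_mh[OF k1 that(3)] .
      moreover have "B v k1 = 0" using orth[of k1 v] k le that B_sym[of v k1] by auto
      moreover have "B u k2 = 0" using orth[of u k2] k le that by auto
      ultimately show "B u k = 0" by (simp add: k B_simps)
    qed
    moreover have "(u + v) - u \<in> m" using calculation that(3) m_subspace by (metis subspace_diff)
    ultimately show ?thesis by simp
  qed
  have dm: "direct_sum m ?m1 ?m2"
    unfolding direct_sum_def
  proof (intro conjI)
    show "subspace ?m1" "subspace ?m2"
      using subspace_inter[OF s(1) m_subspace] subspace_inter[OF s(2) m_subspace] by simp_all
    show "?m1 \<inter> ?m2 = {0}" using s(3) subspace_0[OF m_subspace] by blast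
    show "m = {u + w |u w. u \<in> ?m1 \<and> w \<in> ?m2}"
    proof
      show "m \<subseteq> {u + w |u w. u \<in> ?m1 \<and> w \<in> ?m2}"
      proof
        fix x assume x: "x \<in> m"
        have "x \<in> {u + w |u w. u \<in> g1 \<and> w \<in> g2}" using ds by (auto simp: direct_sum_def)
        then obtain u v where "u \<in> g1" "v \<in> g2" "x = u + v" by blast
        then show "x \<in> {u + w |u w. u \<in> ?m1 \<and> w \<in> ?m2}" using split x by blast
      qed
    qed (use subspace_add[OF m_subspace] in blast)
  qed
  \<comment> \<open>If \<open>V\<close> meets \<open>m\<close> trivially then \<open>m\<close> lies in \<open>U\<close>, so \<open>V\<close> is contained in \<open>h\<close> and kills \<open>m\<close>.\<close>
  have nontrivial: "V \<inter> m \<noteq> {0}"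
    if VU: "V \<noteq> {0}" "subspace V" "subspace U" "V \<inter> U = {0}" "direct_sum h k l" "k \<subseteq> V" "l \<subseteq> U"
      "direct_sum m (V \<inter> m) (U \<inter> m)" "\<And>x y. x \<in> V \<Longrightarrow> y \<in> U \<Longrightarrow> br x y = 0" for V U k l
  proof
    assume V0: "V \<inter> m = {0}"
    have mU: "m \<subseteq> U" using VU(8) unfolding V0 direct_sum_def by auto
    have "x = 0" if x: "x \<in> V" for x
    proof (rule effective_zero)
      obtain p q where pq: "p \<in> k" "q \<in> l" "hc x = p + q"
        using VU(5) hc_mem[of x] unfolding direct_sum_def by blast
      have e: "x - p = q + mc x" using hc_mc[of x] pq by (simp add: algebra_simps)
      have "x - p \<in> V" using x pq VU by (blast intro: subspace_diff)
      moreover have "q + mc x \<in> U" using pq VU mU mc_mem by (blast intro: subspace_add)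
      ultimately have "x - p = 0" using e VU(4) by auto
      then show "x \<in> h" using pq direct_sum_parts[OF VU(5)] by auto
      show "br x y = 0" if "y \<in> m" for y using VU(9) x that mU by blast
    qed
    then show False using VU(1,2) by (auto simp: subspace_0)
  qed
  let ?T = "\<lambda>x y z. - B (br x y) z"
  have form: "three_form_on V ?T" for V
  proof -
    have "B (br x y) y = 0" "B (br x y) x = 0" for x y
      using B_invariant[of x y y] B_sym[of y "br x y"] B_invariant[of x y x] by (auto simp: B_simps)
    then show ?thesis
      by (auto simp: three_form_on_def linear_form_on_def br_simps B_simps algebra_simps)
  qed
  have "m \<inter> g1 \<noteq> {0}" "m \<inter> g2 \<noteq> {0}"
    using nontrivial[OF nz(1) s(1,2,3) dh le dm] comm
      nontrivial[OF nz(2) s(2,1) _ direct_sum_commute[OF dh] le(2,1) direct_sum_commute[OF dm]] s(3)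
    by (auto simp: Int_commute)
  moreover have "torsion_form br h m g x y z =
      ?T (component ?m1 ?m2 x) (component ?m1 ?m2 y) (component ?m1 ?m2 z) +
      ?T (component ?m2 ?m1 x) (component ?m2 ?m1 y) (component ?m2 ?m1 z)"
    if xyz: "x \<in> m" "y \<in> m" "z \<in> m" for x y z
  proof -
    let ?p = "component ?m1 ?m2" and ?q = "component ?m2 ?m1"
    have mem: "?p w \<in> g1" "?q w \<in> g2" and sum: "?p w + ?q w = w" if "w \<in> m" for w
      using component_decomposition[OF dm that] by auto
    have "br (?p x) (?p y) \<in> g1" "br (?q x) (?q y) \<in> g2"
      using I mem xyz by (auto simp: lie_ideal_def)
    then have "B (br (?p x) (?p y)) (?q z) = 0" "B (br (?q x) (?q y)) (?p z) = 0"
      using orth mem xyz B_sym[of "br (?q x) (?q y)" "?p z"] by auto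
    moreover have "br (?p x) (?q y) = 0" "br (?q x) (?p y) = 0" using comm mem xyz by auto
    moreover have "torsion_form br h m g x y z = ?T (?p x + ?q x) (?p y + ?q y) (?p z + ?q z)"
      using xyz sum by (simp add: torsion_form_B)
    ultimately show ?thesis by (simp add: br_simps B_simps)
  qed
  moreover have "\<forall>x\<in>?m1. \<forall>y\<in>?m2. g x y = 0" using orth B_m by force
  ultimately show ?thesis
    unfolding reducible_def using dm form[of ?m1] form[of ?m2]
    by (intro exI[of _ ?m1] exI[of _ ?m2] exI[of _ ?T]) (auto simp: Int_commute)
qed

end

theorem lemma2p13:
  fixes br :: "'a::real_vector \<Rightarrow> 'a \<Rightarrow> 'a"
    and h m :: "'a set"
    and g gbar :: "'a \<Rightarrow> 'a \<Rightarrow> real"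
  assumes "naturally_reductive br h m g"
    and "is_transvection_algebra br h m"
    and "kostant_form br h m g gbar"
    and "\<not> irreducible_symmetric br h m"
  shows "reducible br h m g \<longleftrightarrow>
    (\<exists>g1 g2. lie_ideal br g1 \<and> lie_ideal br g2 \<and> g1 \<noteq> {0} \<and> g2 \<noteq> {0} \<and>
       (\<forall>x\<in>g1. \<forall>y\<in>g2. gbar x y = 0) \<and>
       direct_sum UNIV g1 g2 \<and>
       (\<exists>h1 h2. direct_sum h h1 h2 \<and> h1 \<subseteq> g1 \<and> h2 \<subseteq> g2))"
proof -
  interpret transvection_decomposition br h m g gbar
    by unfold_locales (use assms in auto)
  show ?thesis
    using ideal_splitting_if_reducible[OF _ assms(4)] reducible_if_ideal_splitting
    unfolding ideal_splitting_def by blast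
qed

end
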